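(* Let $k \geq 2$ be an integer. Then $\mathrm{cms}(H) \leq \frac{1}{k+1}|E(H)|$ for any graph $H$ that has $B_k$ as a subgraph. Furthermore, for all integers $n \geq 3k+5$ such that $nk$ is even, there is a $k$-regular graph on $n$ vertices with $B_k$ as a subgraph.
   Context: All graphs are finite and simple. For even $k$, $B_k$ is the complete graph $K_{k+1}$. For odd $k$, $B_k$ is the graph on $k+2$ vertices whose complement is the vertex-disjoint union of a path on $3$ vertices and a perfect matching on the remaining $k-1$ vertices. For a graph $G$ with $m$ edges, an ordering is a bijection $\ell:E(G)\to\mathbb{Z}_m$; $d_\ell(e,e')$ is the smallest positive $d$ with $\ell(e)+d=\ell(e')$ in $\mathbb{Z}_m$, $d_\ell\{e,e'\}=\min\{d_\ell(e,e'),d_\ell(e',e)\}$; $\mathrm{cms}(\ell)$ is the largest $s\in\{1,\dots,m\}$ with $d_\ell\{e,e'\}\geq s$ for all pairs of adjacent (vertex-sharing) edges, and $\mathrm{cms}(G)$ is the maximum of $\mathrm{cms}(\ell)$ over all orderings of $G$. *)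

theory Defs
  imports Complex_Main "HOL-Library.Ramsey" "HOL-Number_Theory.Cong"
begin

record 'a sgraph =
  verts :: "'a set"
  edges :: "'a set set"

text \<open>Finite simple graphs; \<^term>\<open>nsets V 2\<close>, also written \<open>[V]\<^bsup>2\<^esup>\<close>, is the set of
  2-element subsets of \<^term>\<open>V\<close>.\<close>

definition simple_graph :: "'a sgraph \<Rightarrow> bool" where
  "simple_graph G \<longleftrightarrow> finite (verts G) \<and> edges G \<subseteq> nsets (verts G) 2"

definition complement :: "'a sgraph \<Rightarrow> 'a sgraph" where
  "complement G = \<lparr>verts = verts G, edges = nsets (verts G) 2 - edges G\<rparr>"

definition degree :: "'a sgraph \<Rightarrow> 'a \<Rightarrow> nat" where
  "degree G v = card {e \<in> edges G. v \<in> e}"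

definition regular :: "nat \<Rightarrow> 'a sgraph \<Rightarrow> bool" where
  "regular k G \<longleftrightarrow> (\<forall>v \<in> verts G. degree G v = k)"

definition subgraph :: "'a sgraph \<Rightarrow> 'a sgraph \<Rightarrow> bool" where
  "subgraph F G \<longleftrightarrow> simple_graph F \<and> verts F \<subseteq> verts G \<and> edges F \<subseteq> edges G"

definition isomorphic :: "'a sgraph \<Rightarrow> 'b sgraph \<Rightarrow> bool" where
  "isomorphic F G \<longleftrightarrow>
     (\<exists>f. bij_betw f (verts F) (verts G) \<and> edges G = (\<lambda>e. f ` e) ` edges F)"

text \<open>As usual, having a fixed graph as a subgraph is meant up to isomorphism, and
  the subgraph need not be induced.\<close>

definition has_as_subgraph :: "'a sgraph \<Rightarrow> 'b sgraph \<Rightarrow> bool" where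
  "has_as_subgraph G B \<longleftrightarrow> (\<exists>F. subgraph F G \<and> isomorphic B F)"

definition complete_graph :: "nat \<Rightarrow> nat sgraph" where
  "complete_graph n = \<lparr>verts = {..<n}, edges = nsets {..<n} 2\<rparr>"

text \<open>For odd \<^term>\<open>k\<close>, on the vertices \<open>0, \<dots>, k + 1\<close>: the path \<open>0 - 1 - 2\<close> together with the
  perfect matching \<open>3 - 4, 5 - 6, \<dots>, k - (k + 1)\<close> on the remaining \<open>k - 1\<close> vertices.\<close>

definition path_plus_matching :: "nat \<Rightarrow> nat sgraph" where
  "path_plus_matching k =
     \<lparr>verts = {..<k + 2},
      edges = {{0, 1}, {1, 2}} \<union> (\<lambda>i. {2 * i + 1, 2 * i + 2}) ` {1..(k - 1) div 2}\<rparr>"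

definition B_graph :: "nat \<Rightarrow> nat sgraph" where
  "B_graph k = (if even k then complete_graph (k + 1) else complement (path_plus_matching k))"

definition adjacent_edges :: "'a set \<Rightarrow> 'a set \<Rightarrow> bool" where
  "adjacent_edges e e' \<longleftrightarrow> e \<noteq> e' \<and> e \<inter> e' \<noteq> {}"

text \<open>The integers modulo \<open>m\<close> are represented by the residues \<open>0, \<dots>, m - 1\<close>; equality in
  \<open>\<int>\<^sub>m\<close> is congruence modulo \<open>m\<close>.\<close>

definition edge_ordering :: "'a sgraph \<Rightarrow> ('a set \<Rightarrow> nat) \<Rightarrow> bool" where
  "edge_ordering G l \<longleftrightarrow> bij_betw l (edges G) {..<card (edges G)}"

definition cyc_dist :: "'a sgraph \<Rightarrow> ('a set \<Rightarrow> nat) \<Rightarrow> 'a set \<Rightarrow> 'a set \<Rightarrow> nat" where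
  "cyc_dist G l e e' = (LEAST d. 0 < d \<and> [l e + d = l e'] (mod card (edges G)))"

definition cyc_dist_sym :: "'a sgraph \<Rightarrow> ('a set \<Rightarrow> nat) \<Rightarrow> 'a set \<Rightarrow> 'a set \<Rightarrow> nat" where
  "cyc_dist_sym G l e e' = min (cyc_dist G l e e') (cyc_dist G l e' e)"

definition cms_ordering :: "'a sgraph \<Rightarrow> ('a set \<Rightarrow> nat) \<Rightarrow> nat" where
  "cms_ordering G l =
     Max {s \<in> {1..card (edges G)}.
            \<forall>e \<in> edges G. \<forall>e' \<in> edges G. adjacent_edges e e' \<longrightarrow> s \<le> cyc_dist_sym G l e e'}"

text \<open>Only meaningful for graphs with at least one edge; then both maxima are over finite
  nonempty sets.\<close>

definition cms :: "'a sgraph \<Rightarrow> nat" where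
  "cms G = Max {cms_ordering G l |l. edge_ordering G l}"

end

theory Submission imports Defs begin

text \<open>
  Let \<open>s = cms H\<close>, \<open>m = |E(H)|\<close>, and let \<open>p\<close> be the largest size of a matching that fits into
  the vertices of \<open>B\<^sub>k\<close>. Enumerate the \<open>N\<close> edges of \<open>B\<^sub>k\<close> inside \<open>H\<close> cyclically as \<open>E i\<close>, at
  positions \<open>Q i\<close> with \<open>Q (i + N) = Q i + m\<close>. Edges at distance less than \<open>s\<close> are disjoint, so
  \<open>Q (i + p) \<ge> Q i + s\<close>. For even \<open>k\<close> we have \<open>N = (k + 1) p\<close>, and \<open>m \<ge> (k + 1) s\<close> follows at once.

  For odd \<open>k\<close> we have \<open>N = (k + 1) p - 1\<close>. If \<open>m < (k + 1) s\<close>, then the bound above forces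
  \<open>Q (i + p - 1) < Q i + s\<close>, so any \<open>p\<close> consecutive edges of \<open>B\<^sub>k\<close> form a matching missing exactly
  one vertex. Let \<open>w\<close> be the vertex of degree \<open>k - 1\<close>. If \<open>p + 1\<close> consecutive edges all avoided \<open>w\<close>,
  the first and the last of them would both be the complement of the others in the set of vertices
  other than \<open>w\<close>, hence equal. So every \<open>p + 1\<close> consecutive edges contain one of the \<open>k - 1\<close> edges
  at \<open>w\<close>, and double counting gives \<open>N \<le> (p + 1)(k - 1) < N\<close>.

  For the construction, add to \<open>B\<^sub>k\<close> a disjoint circulant graph; for odd \<open>k\<close> that graph has
  \<open>2 h + 1\<close> vertices and is enlarged by the matching \<open>i - (i + h)\<close>, \<open>i < h\<close>, after which the only
  vertices of degree \<open>k - 1\<close> are \<open>2 h\<close> and \<open>w\<close>, and these are joined by an edge.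
\<close>

section \<open>Cyclic enumerations of edges\<close>

lemma bij_betw_add_mod:
  fixes i N :: nat
  assumes "N > 0"
  shows "bij_betw (\<lambda>j. (i + j) mod N) {..<N} {..<N}"
proof -
  have inj: "inj_on (\<lambda>j. (i + j) mod N) {..<N}"
  proof (rule inj_onI)
    fix x y assume "x \<in> {..<N}" "y \<in> {..<N}" "(i + x) mod N = (i + y) mod N"
    then show "x = y"
      using cong_add_lcancel_nat[of i x y N] cong_less_modulus_unique_nat[of x y N]
      by (auto simp: cong_def)
  qed
  have "(\<lambda>j. (i + j) mod N) ` {..<N} \<subseteq> {..<N}"
    using assms by auto
  with inj show ?thesis
    by (simp add: bij_betw_def endo_inj_surj)
qed

text \<open>The labels of \<open>A\<close>, sorted increasingly, are repeated with period
  \<open>card A\<close>, gaining \<open>m\<close> each round. They need not fill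
  \<open>{..<m}\<close>, so consecutive values of \<open>Q\<close> may be far apart.\<close>

lemma cyclic_enumeration:
  fixes l :: "'b \<Rightarrow> nat"
  assumes "finite A" "A \<noteq> {}" and inj: "inj_on l A" and lt: "l ` A \<subseteq> {..<m}"
  obtains Q :: "nat \<Rightarrow> nat" and E :: "nat \<Rightarrow> 'b"
  where "strict_mono Q" "\<And>i. Q (i + card A) = Q i + m"
    "\<And>i. bij_betw (\<lambda>j. E (i + j)) {..<card A} A" "\<And>i. l (E i) = Q i mod m"
proof -
  define N where "N = card A"
  have N: "N > 0" using assms by (simp add: N_def card_gt_0_iff)
  have "card (l ` A) = N" using inj by (simp add: card_image N_def)
  then obtain h where h: "bij_betw h {0..<N} (l ` A)" "strict_mono_on {0..<N} h"
    using ex_bij_betw_strict_mono_card[of "l ` A"] \<open>finite A\<close>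
    by (metis finite_imageI atLeast0LessThan)
  have hlt: "h j < m" and himg: "h j \<in> l ` A" if "j < N" for j
    using h(1) lt that unfolding bij_betw_def by fastforce+
  define g where "g = inv_into A l"
  have lg: "l (g y) = y" if "y \<in> l ` A" for y
    using that by (simp add: g_def f_inv_into_f)
  define Q where "Q i = h (i mod N) + m * (i div N)" for i
  define E where "E i = g (h (i mod N))" for i
  have 1: "strict_mono Q"
    unfolding strict_mono_Suc_iff
  proof
    fix i
    show "Q i < Q (Suc i)"
    proof (cases "Suc (i mod N) = N")
      case True
      then have "Suc i mod N = 0" "Suc i div N = Suc (i div N)"
        by (simp_all add: mod_Suc div_Suc)
      moreover have "h (i mod N) < m" using hlt N by simp
      ultimately show ?thesis by (simp add: Q_def)
    next
      case False
      then have "Suc i mod N = Suc (i mod N)" "Suc i div N = i div N"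
        by (simp_all add: mod_Suc div_Suc)
      moreover have "Suc (i mod N) < N" using False N
        by (metis Suc_lessI mod_less_divisor)
      then have "h (i mod N) < h (Suc (i mod N))"
        using h(2) by (auto simp: strict_mono_on_def)
      ultimately show ?thesis by (simp add: Q_def)
    qed
  qed
  have 2: "Q (i + N) = Q i + m" for i
    using N by (simp add: Q_def)
  have 3: "bij_betw (\<lambda>j. E (i + j)) {..<N} A" for i
  proof -
    have "bij_betw g (l ` A) A"
      using inj unfolding g_def by (simp add: bij_betw_inv_into inj_on_imp_bij_betw)
    moreover have "bij_betw h {..<N} (l ` A)" using h(1) by (simp add: atLeast0LessThan)
    ultimately have "bij_betw (g \<circ> (h \<circ> (\<lambda>j. (i + j) mod N))) {..<N} A"
      using bij_betw_add_mod[OF N, of i] by (blast intro: bij_betw_trans)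
    then show ?thesis by (simp add: E_def[abs_def] comp_def)
  qed
  have 4: "l (E i) = Q i mod m" for i
    using N hlt[of "i mod N"] himg[of "i mod N"] by (simp add: E_def Q_def lg)
  show thesis using that[of Q E] 1 2 3 4 by (simp add: N_def)
qed

lemma neq_of_inj_on_shift:
  fixes f :: "nat \<Rightarrow> 'b"
  assumes "inj_on (\<lambda>j. f (i + j)) {..<N}" "i < j" "j < i + N"
  shows "f i \<noteq> f j"
proof
  assume "f i = f j"
  then have "f (i + 0) = f (i + (j - i))" using assms(2) by simp
  from inj_onD[OF assms(1) this] assms(2,3) show False by (auto simp: less_diff_conv2)
qed

text \<open>Positions are unrolled along the natural numbers, so that windows of consecutive edges never
  wrap around.\<close>

locale spread_enumeration =
  fixes A :: "'a set set" and V :: "'a set" and Q :: "nat \<Rightarrow> nat"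
    and E :: "nat \<Rightarrow> 'a set" and s m :: nat
  assumes finite_V: "finite V" and A_subset: "A \<subseteq> nsets V 2"
    and mono_Q: "strict_mono Q" and Q_period: "\<And>i. Q (i + card A) = Q i + m"
    and E_bij: "\<And>i. bij_betw (\<lambda>j. E (i + j)) {..<card A} A"
    and spread: "\<And>i j. \<lbrakk>i < j; j < i + card A; Q j < Q i + s\<rbrakk> \<Longrightarrow> E i \<inter> E j = {}"
begin

lemma E_neq: "\<lbrakk>i < j; j < i + card A\<rbrakk> \<Longrightarrow> E i \<noteq> E j"
  using E_bij[of i] by (intro neq_of_inj_on_shift) (auto simp: bij_betw_def)

lemma E_nsets: "card A > 0 \<Longrightarrow> E i \<in> nsets V 2"
  using bij_betwE[OF E_bij[of i]] A_subset by (metis add.right_neutral lessThan_iff subsetD)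

lemma window_disjoint:
  assumes "q < card A" "Q (i + q) < Q i + s" "a \<in> {i..i+q}" "b \<in> {i..i+q}" "a \<noteq> b"
  shows "E a \<inter> E b = {}"
proof -
  have *: "E a \<inter> E b = {}" if "a < b" "a \<in> {i..i+q}" "b \<in> {i..i+q}" for a b
  proof (rule spread)
    have "Q i \<le> Q a" "Q b \<le> Q (i + q)"
      using that mono_Q by (auto simp: strict_mono_less_eq)
    then show "Q b < Q a + s" using assms(2) by linarith
  qed (use that assms(1) in auto)
  show ?thesis using *[of a b] *[of b a] assms by (cases "a < b") auto
qed

lemma card_window:
  assumes "q < card A" "Q (i + q) < Q i + s" "J \<subseteq> {i..i+q}"
  shows "card (\<Union>(E ` J)) = 2 * card J" "\<Union>(E ` J) \<subseteq> V"
proof -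
  have E: "finite (E j)" "card (E j) = 2" "E j \<subseteq> V" for j
    using E_nsets[of j] assms(1) by (auto simp: nsets_def)
  have "card (\<Union>(E ` J)) = (\<Sum>j\<in>J. card (E j))"
  proof (rule card_UN_disjoint)
    show "finite J" using assms(3) finite_subset by blast
    show "\<forall>a\<in>J. \<forall>b\<in>J. a \<noteq> b \<longrightarrow> E a \<inter> E b = {}"
      using window_disjoint[OF assms(1,2)] assms(3) by blast
  qed (use E in auto)
  then show "card (\<Union>(E ` J)) = 2 * card J" using E by simp
  show "\<Union>(E ` J) \<subseteq> V" using E by auto
qed

text \<open>More than \<open>p\<close> pairwise disjoint edges do not fit into \<open>V\<close>, so
  \<open>p\<close> steps advance the position by at least \<open>s\<close>; this is iterated over
  \<open>j\<close> consecutive blocks.\<close>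

lemma matching_bound:
  assumes "p < card A" "card V < 2 * (p + 1)"
  shows "Q i + j * s \<le> Q (i + j * p)"
proof (induction j)
  case (Suc j)
  have "Q x + s \<le> Q (x + p)" for x
  proof (rule ccontr)
    assume "\<not> ?thesis"
    then have "card (\<Union>(E ` {x..x+p})) = 2 * card {x..x+p}" "\<Union>(E ` {x..x+p}) \<subseteq> V"
      using card_window[of p x "{x..x+p}"] assms by auto
    then have "2 * (p + 1) \<le> card V"
      using card_mono[OF finite_V, of "\<Union>(E ` {x..x+p})"] by simp
    then show False using assms(2) by simp
  qed
  from this[of "i + j * p"] Suc show ?case by (simp add: algebra_simps)
qed simp

lemma even_case:
  assumes "card A = (k + 1) * p" "p > 0" "k > 0" "card V < 2 * (p + 1)"
  shows "(k + 1) * s \<le> m"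
proof -
  have "p < card A" using assms by simp
  from matching_bound[OF this assms(4), of 0 "k + 1"] Q_period[of 0] assms(1)
  show ?thesis by simp
qed

text \<open>Here a round is one edge short of \<open>k + 1\<close> full blocks, so block counting
  yields only \<open>k * s \<le> m\<close>; the low degree of \<open>w\<close> makes up for the
  missing edge.\<close>

lemma odd_case:
  assumes card_A: "card A + 1 = (k + 1) * p" and k: "k + 1 = 2 * p" "p \<ge> 2"
    and card_V: "card V = 2 * p + 1"
    and w: "w \<in> V" "card {e \<in> A. w \<in> e} = k - 1"
  shows "(k + 1) * s \<le> m"
proof (rule ccontr)
  assume "\<not> ?thesis"
  then have m: "m < (k + 1) * s" by simp
  have pA: "p < card A"
  proof -
    have "3 * p \<le> (k + 1) * p" using k by (intro mult_right_mono) auto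
    then show ?thesis using card_A k by linarith
  qed
  have NA: "card A = p - 1 + k * p" using card_A k(2) by simp
  \<comment> \<open>The last \<open>k\<close> blocks of the round that starts at \<open>i\<close>
    take up at least \<open>k * s\<close> of the \<open>m < (k + 1) * s\<close> positions, leaving
    less than \<open>s\<close> for the first \<open>p - 1\<close> steps.\<close>
  have close: "Q (i + (p - 1)) < Q i + s" for i
  proof -
    have "Q (i + (p - 1)) + k * s \<le> Q (i + (p - 1) + k * p)"
      using matching_bound[OF pA] card_V by simp
    also have "\<dots> = Q i + m" using Q_period[of i] NA by (simp add: add.assoc)
    finally show ?thesis using m by simp
  qed
  have hit: "\<exists>j\<in>{..p}. w \<in> E (i + j)" for i
  proof (rule ccontr)
    assume no: "\<not> ?thesis"
    then have nw: "w \<notin> E j" if "j \<in> {i..i+p}" for j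
      using that by (metis atLeastAtMost_iff atMost_iff le_add_diff_inverse nat_add_left_cancel_le)
    define C where "C = \<Union>(E ` {i+1..i+(p-1)})"
    \<comment> \<open>Used for both ends: \<open>a = i\<close> with \<open>x = i\<close>, and
      \<open>a = i + p\<close> with \<open>x = i + 1\<close>; the two windows share the edges of
      \<open>C\<close>. Each window has \<open>p\<close> disjoint edges avoiding \<open>w\<close>,
      which fill the \<open>2 * p\<close> vertices of \<open>V - {w}\<close>.\<close>
    have cover: "E a \<union> C = V - {w}" "E a \<inter> C = {}"
      if a: "a = x \<or> a = x + (p - 1)" "x = i \<or> x = i + 1" "insert a {i+1..i+(p-1)} = {x..x+(p-1)}"
        "a \<notin> {i+1..i+(p-1)}" for a x
    proof -
      have U: "E a \<union> C = \<Union>(E ` {x..x+(p-1)})" using a(3) by (auto simp: C_def simp flip: a(3))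
      have "card (\<Union>(E ` {x..x+(p-1)})) = 2 * p" "\<Union>(E ` {x..x+(p-1)}) \<subseteq> V"
        using card_window[of "p - 1" x "{x..x+(p-1)}"] pA close k by auto
      moreover have "w \<notin> \<Union>(E ` {x..x+(p-1)})" using nw a(2) k by auto
      ultimately show "E a \<union> C = V - {w}"
        unfolding U using finite_V card_V w(1)
        by (intro card_subset_eq) auto
      show "E a \<inter> C = {}"
      proof -
        have "\<forall>b\<in>{i+1..i+(p-1)}. E a \<inter> E b = {}"
        proof
          fix b assume b: "b \<in> {i+1..i+(p-1)}"
          show "E a \<inter> E b = {}"
        proof (rule window_disjoint)
          show "p - 1 < card A" using pA by simp
          show "a \<in> {x..x+(p-1)}" "b \<in> {x..x+(p-1)}" using a(3) b by blast+
          show "a \<noteq> b" using a(4) b by blast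
          qed (rule close)
        qed
        then show ?thesis unfolding C_def by blast
      qed
    qed
    have "insert i {i+1..i+(p-1)} = {i..i+(p-1)}" by auto
    from cover[OF _ _ this]
    have "E i \<union> C = V - {w}" "E i \<inter> C = {}" by simp_all
    moreover have "insert (i + p) {i+1..i+(p-1)} = {i+1..i+1+(p-1)}"
      using k(2) by auto
    from cover[OF _ _ this]
    have "E (i + p) \<union> C = V - {w}" "E (i + p) \<inter> C = {}" using k(2) by simp_all
    ultimately have "E i = E (i + p)" by blast
    then show False using E_neq[of i "i + p"] pA k by simp
  qed
  have count: "card {i \<in> {..<card A}. w \<in> E (i + j)} = k - 1" for j
  proof -
    have b: "bij_betw (\<lambda>i. E (i + j)) {..<card A} A" using E_bij[of j] by (simp add: add.commute)
    then have img: "(\<lambda>i. E (i + j)) ` {i \<in> {..<card A}. w \<in> E (i + j)} = {e \<in> A. w \<in> e}"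
      unfolding bij_betw_def by auto
    have "inj_on (\<lambda>i. E (i + j)) {i \<in> {..<card A}. w \<in> E (i + j)}"
      using b by (rule inj_on_subset[OF bij_betw_imp_inj_on]) blast
    from card_image[OF this] show ?thesis unfolding img w(2) by simp
  qed
  \<comment> \<open>Pairs \<open>(i, j)\<close> with \<open>w \<in> E (i + j)\<close> are counted
    twice: every \<open>i\<close> has some \<open>j \<le> p\<close>, and every \<open>j\<close> has
    exactly \<open>k - 1\<close> indices \<open>i\<close>, since a shifted round still lists
    \<open>A\<close> once.\<close>
  have "card A = (\<Sum>i<card A. 1)" by simp
  also have "\<dots> \<le> (\<Sum>i<card A. \<Sum>j\<le>p. of_bool (w \<in> E (i + j)))"
  proof (rule sum_mono)
    fix i
    obtain j where "j \<in> {..p}" "w \<in> E (i + j)" using hit by blast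
    then show "1 \<le> (\<Sum>j\<le>p. of_bool (w \<in> E (i + j)) :: nat)"
      using member_le_sum[of j "{..p}" "\<lambda>j. of_bool (w \<in> E (i + j)) :: nat"] by simp
  qed
  also have "\<dots> = (\<Sum>j\<le>p. \<Sum>i<card A. of_bool (w \<in> E (i + j)))" by (rule sum.swap)
  also have "\<dots> = (\<Sum>j\<le>p. k - 1)"
    using count by (intro sum.cong) (auto simp: of_bool_def sum.If_cases Int_def)
  also have "\<dots> = (p + 1) * (k - 1)" by simp
  finally have "card A \<le> (p + 1) * (k - 1)" .
  \<comment> \<open>The contradiction is by one: \<open>card A = 2 * p * p - 1\<close>, while
    \<open>(p + 1) * (k - 1) = 2 * p * p - 2\<close>.\<close>
  moreover have "k - 1 = 2 * (p - 1)" using k by simp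
  moreover obtain t where "p = Suc t" using k by (cases p) auto
  ultimately show False using card_A k(1) by (simp add: algebra_simps)
qed

end

section \<open>Cyclic matching sequenceability\<close>

lemma cyc_dist_le:
  assumes "0 < d" "[l e + d = l e'] (mod card (edges G))"
  shows "cyc_dist G l e e' \<le> d"
  unfolding cyc_dist_def using assms by (intro Least_le) simp

lemma cyc_dist_pos:
  assumes "l e < card (edges G)"
  shows "0 < cyc_dist G l e e'"
proof -
  \<comment> \<open>The witness runs from \<open>l e\<close> to the end of the cycle and on to
    \<open>l e'\<close>; it is positive because \<open>l e\<close> is below the modulus, so the
    \<open>LEAST\<close> is over a nonempty set.\<close>
  have "[l e + (card (edges G) - l e + l e') = l e'] (mod card (edges G))"
    using assms by (simp add: cong_def)
  then have "\<exists>d. 0 < d \<and> [l e + d = l e'] (mod card (edges G))"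
    using assms by (intro exI[of _ "card (edges G) - l e + l e'"]) simp
  then show ?thesis
    unfolding cyc_dist_def by (rule LeastI2_ex) simp
qed

text \<open>All cyclic distances are positive, so the value 1 is admissible and the maximum is taken
  over a nonempty finite set.\<close>

lemma cms_ordering_attained:
  assumes "edge_ordering G l" "edges G \<noteq> {}" "finite (edges G)"
  shows "cms_ordering G l \<in> {s \<in> {1..card (edges G)}.
            \<forall>e \<in> edges G. \<forall>e' \<in> edges G. adjacent_edges e e' \<longrightarrow> s \<le> cyc_dist_sym G l e e'}"
  unfolding cms_ordering_def
proof (rule Max_in)
  have "l e < card (edges G)" if "e \<in> edges G" for e
    using assms(1) that by (auto simp: edge_ordering_def bij_betw_def)
  then have "1 \<in> {s \<in> {1..card (edges G)}.
      \<forall>e \<in> edges G. \<forall>e' \<in> edges G. adjacent_edges e e' \<longrightarrow> s \<le> cyc_dist_sym G l e e'}"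
    using assms cyc_dist_pos[of l _ G]
    by (auto simp: cyc_dist_sym_def Suc_le_eq card_gt_0_iff)
  then show "{s \<in> {1..card (edges G)}.
      \<forall>e \<in> edges G. \<forall>e' \<in> edges G. adjacent_edges e e' \<longrightarrow> s \<le> cyc_dist_sym G l e e'} \<noteq> {}"
    by blast
qed simp

text \<open>Orderings are arbitrary off the edges, so there may be infinitely many; but their values
  lie in \<open>{1..card (edges G)}\<close>, hence the maximum is attained.\<close>

lemma cms_attained:
  assumes "finite (edges G)" "edges G \<noteq> {}"
  obtains l where "edge_ordering G l" "cms G = cms_ordering G l"
proof -
  have "{cms_ordering G l |l. edge_ordering G l} \<subseteq> {1..card (edges G)}"
    using cms_ordering_attained assms by fastforce
  then have "finite {cms_ordering G l |l. edge_ordering G l}"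
    by (rule finite_subset) simp
  moreover have "\<exists>l. edge_ordering G l"
    using ex_bij_betw_finite_nat[OF assms(1)] by (auto simp: edge_ordering_def atLeast0LessThan)
  ultimately have "cms G \<in> {cms_ordering G l |l. edge_ordering G l}"
    unfolding cms_def by (intro Max_in) auto
  with that show thesis by blast
qed

text \<open>An optimal ordering of all of \<open>H\<close>, restricted to \<open>A\<close>, supplies
  the positions. Within a round, \<open>Q j - Q i\<close> is a candidate for the cyclic distance
  from \<open>E i\<close> to \<open>E j\<close>, so it is at least \<open>cms H\<close> if the two
  edges meet.\<close>

lemma cms_spread_enumeration:
  assumes fin: "finite (edges H)" and A: "A \<subseteq> edges H" "A \<noteq> {}" "A \<subseteq> nsets V 2" and V: "finite V"
  obtains Q E where "spread_enumeration A V Q E (cms H) (card (edges H))"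
proof -
  define m where "m = card (edges H)"
  obtain l where l: "edge_ordering H l" "cms H = cms_ordering H l"
    using cms_attained[OF fin] A by blast
  have s: "cms H \<le> cyc_dist H l e e'"
    if "e \<in> edges H" "e' \<in> edges H" "e \<noteq> e'" "e \<inter> e' \<noteq> {}" for e e'
    using cms_ordering_attained[OF l(1) _ fin] that l(2)
    by (auto simp: adjacent_edges_def cyc_dist_sym_def)
  have "finite A" "inj_on l A" "l ` A \<subseteq> {..<m}"
    using A fin l(1) by (auto simp: edge_ordering_def bij_betw_def m_def
        intro: finite_subset inj_on_subset)
  from cyclic_enumeration[OF this(1) A(2) this(2,3)]
  obtain Q E where QE: "strict_mono Q" "\<And>i. Q (i + card A) = Q i + m"
    "\<And>i. bij_betw (\<lambda>j. E (i + j)) {..<card A} A" "\<And>i. l (E i) = Q i mod m"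
    by metis
  have EA: "E i \<in> A" for i
  proof -
    have "0 < card A" using \<open>finite A\<close> A(2) by (simp add: card_gt_0_iff)
    then show ?thesis using bij_betwE[OF QE(3)[of i]] by force
  qed
  have "spread_enumeration A V Q E (cms H) m"
  proof
    fix i j assume ij: "i < j" "j < i + card A" "Q j < Q i + cms H"
    show "E i \<inter> E j = {}"
    proof (rule ccontr)
      assume "E i \<inter> E j \<noteq> {}"
      moreover have "E i \<noteq> E j"
        using QE(3)[of i] ij by (intro neq_of_inj_on_shift) (auto simp: bij_betw_def)
      ultimately have "cms H \<le> cyc_dist H l (E i) (E j)"
        using s EA A(1) by blast
      also have "\<dots> \<le> Q j - Q i"
      proof (rule cyc_dist_le)
        have "Q i < Q j" using QE(1) ij(1) by (rule strict_monoD)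
        then show "0 < Q j - Q i" by simp
        have "[Q i mod m + (Q j - Q i) = Q i + (Q j - Q i)] (mod m)"
          by (simp add: cong_def mod_add_left_eq)
        then show "[l (E i) + (Q j - Q i) = l (E j)] (mod card (edges H))"
          using \<open>Q i < Q j\<close> by (simp add: QE(4) cong_def flip: m_def)
      qed
      finally show False using ij(3) strict_monoD[OF QE(1) ij(1)] by linarith
    qed
  qed (use QE V A in auto)
  then show thesis using that unfolding m_def by blast
qed

section \<open>Degrees in edge sets\<close>

definition edge_degree :: "'a set set \<Rightarrow> 'a \<Rightarrow> nat" where
  "edge_degree E v = card {e \<in> E. v \<in> e}"

lemma degree_eq_edge_degree: "degree G v = edge_degree (edges G) v"
  by (simp add: degree_def edge_degree_def)

lemma edge_degree_Un:
  assumes "finite E" "finite F" "E \<inter> F = {}"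
  shows "edge_degree (E \<union> F) v = edge_degree E v + edge_degree F v"
proof -
  have "{e \<in> E \<union> F. v \<in> e} = {e \<in> E. v \<in> e} \<union> {e \<in> F. v \<in> e}" by blast
  then show ?thesis
    unfolding edge_degree_def using assms by (simp add: card_Un_disjoint disjoint_iff)
qed

lemma edge_degree_image:
  assumes "inj_on f V" "E \<subseteq> Pow V" "v \<in> V"
  shows "edge_degree ((`) f ` E) (f v) = edge_degree E v"
proof -
  have "f v \<in> f ` e \<longleftrightarrow> v \<in> e" if "e \<in> E" for e
    using inj_on_image_mem_iff[OF assms(1,3)] assms(2) that by blast
  then have "{e \<in> (`) f ` E. f v \<in> e} = (`) f ` {e \<in> E. v \<in> e}" by blast
  moreover have "inj_on ((`) f) {e \<in> E. v \<in> e}"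
    using inj_on_image_Pow[OF assms(1)] assms(2) by (auto intro: inj_on_subset)
  ultimately show ?thesis by (simp add: edge_degree_def card_image)
qed

lemma edge_degree_disjoint_union:
  fixes b v :: nat
  assumes "E \<subseteq> Pow {..<b}"
  shows "edge_degree (E \<union> (`) ((+) b) ` F) v =
    (if v < b then edge_degree E v else edge_degree F (v - b))"
proof (cases "v < b")
  case True
  then have "{e \<in> E \<union> (`) ((+) b) ` F. v \<in> e} = {e \<in> E. v \<in> e}" by auto
  then show ?thesis using True by (simp add: edge_degree_def)
next
  case False
  then have "{e \<in> E \<union> (`) ((+) b) ` F. v \<in> e} = {e \<in> (`) ((+) b) ` F. b + (v - b) \<in> e}"
    using assms by auto
  then show ?thesis
    using False edge_degree_image[of "(+) b" UNIV F "v - b"] by (simp add: edge_degree_def)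
qed

lemma edge_degree_nsets_diff:
  assumes "finite V" "E \<subseteq> nsets V 2" "v \<in> V"
  shows "edge_degree (nsets V 2 - E) v = card V - 1 - edge_degree E v"
proof -
  have "{e \<in> nsets V 2. v \<in> e} = (\<lambda>u. {v, u}) ` (V - {v})"
    using assms(3) by (auto simp: nsets_def card_2_iff)
  moreover have "inj_on (\<lambda>u. {v, u}) (V - {v})"
    by (auto simp: inj_on_def doubleton_eq_iff)
  ultimately have K: "card {e \<in> nsets V 2. v \<in> e} = card V - 1"
    using assms by (simp add: card_image)
  have "{e \<in> nsets V 2 - E. v \<in> e} = {e \<in> nsets V 2. v \<in> e} - {e \<in> E. v \<in> e}" by blast
  moreover have "finite {e \<in> E. v \<in> e}"
    using assms finite_subset[OF assms(2) finite_imp_finite_nsets] by simp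
  moreover have "{e \<in> E. v \<in> e} \<subseteq> {e \<in> nsets V 2. v \<in> e}" using assms(2) by blast
  ultimately show ?thesis by (simp add: edge_degree_def card_Diff_subset K)
qed

section \<open>Circulant graphs\<close>

definition circulant :: "nat \<Rightarrow> nat set \<Rightarrow> nat set set" where
  "circulant N D = {{u, (u + j) mod N} |u j. u < N \<and> j \<in> D}"

lemma add_mod_eq:
  fixes u j N :: nat
  assumes "u < N" "j < N"
  shows "(u + j) mod N = (if u + j < N then u + j else u + j - N)"
  using assms by (simp add: le_mod_geq)

lemma circulant_subset:
  assumes "D \<subseteq> {1..<N}"
  shows "circulant N D \<subseteq> nsets {..<N} 2"
proof
  fix e assume "e \<in> circulant N D"
  then obtain u j where e: "e = {u, (u + j) mod N}" "u < N" "j \<in> D"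
    by (auto simp: circulant_def)
  moreover have "j < N" "j > 0" using assms e(3) by auto
  ultimately have "u \<noteq> (u + j) mod N" "(u + j) mod N < N"
    using add_mod_eq[of u N j] by (auto split: if_splits)
  then show "e \<in> nsets {..<N} 2" using e by (simp add: nsets_def)
qed

text \<open>As \<open>D\<close> is closed under negation modulo \<open>N\<close>, an edge leaving
  \<open>u\<close> by step \<open>j\<close> leaves its other end by step \<open>N - j\<close>. So
  the edges at \<open>v\<close> correspond to the elements of \<open>D\<close>.\<close>

lemma edge_degree_circulant:
  assumes D: "D \<subseteq> {1..<N}" "\<And>j. j \<in> D \<Longrightarrow> N - j \<in> D" and v: "v < N"
  shows "edge_degree (circulant N D) v = card D"
proof -
  have "{e \<in> circulant N D. v \<in> e} = (\<lambda>j. {v, (v + j) mod N}) ` D"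
  proof (intro equalityI subsetI)
    fix e assume "e \<in> {e \<in> circulant N D. v \<in> e}"
    then obtain u j where e: "e = {u, (u + j) mod N}" "u < N" "j \<in> D" "v \<in> e"
      by (auto simp: circulant_def)
    have j: "j < N" "j > 0" using D(1) e(3) by auto
    show "e \<in> (\<lambda>j. {v, (v + j) mod N}) ` D"
    proof (cases "v = u")
      case False
      then have "v = (u + j) mod N" using e by blast
      then have "(v + (N - j)) mod N = u"
        using e(2) j v by (auto simp: add_mod_eq split: if_splits)
      then have "e = {v, (v + (N - j)) mod N}" using e(1) \<open>v = (u + j) mod N\<close> by auto
      then show ?thesis using D(2)[OF e(3)] by blast
    qed (use e in blast)
  next
    fix e assume "e \<in> (\<lambda>j. {v, (v + j) mod N}) ` D"
    then show "e \<in> {e \<in> circulant N D. v \<in> e}" using v by (auto simp: circulant_def)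
  qed
  moreover have "inj_on (\<lambda>j. {v, (v + j) mod N}) D"
  proof (rule inj_onI)
    fix x y assume xy: "x \<in> D" "y \<in> D" "{v, (v + x) mod N} = {v, (v + y) mod N}"
    then have "(v + x) mod N = (v + y) mod N" by (auto simp: doubleton_eq_iff)
    moreover have "inj_on (\<lambda>j. (v + j) mod N) {..<N}"
      using bij_betw_add_mod[of N v] v by (auto simp: bij_betw_def)
    moreover have "x \<in> {..<N}" "y \<in> {..<N}" using xy D(1) by auto
    ultimately show "x = y" by (blast dest: inj_onD)
  qed
  ultimately show ?thesis by (simp add: edge_degree_def card_image)
qed

text \<open>The residues of 1, ..., \<open>d\<close> and their negatives modulo \<open>N\<close>: as
  a connection set, it joins each vertex to the \<open>d\<close> nearest ones on either
  side.\<close>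

definition short_steps :: "nat \<Rightarrow> nat \<Rightarrow> nat set" where
  "short_steps N d = {1..d} \<union> {N - d..<N}"

lemma short_steps:
  assumes "2 * d < N"
  shows "short_steps N d \<subseteq> {1..<N}" "\<And>j. j \<in> short_steps N d \<Longrightarrow> N - j \<in> short_steps N d"
    "card (short_steps N d) = 2 * d"
proof -
  have "card (short_steps N d) = card {1..d} + card {N - d..<N}"
    unfolding short_steps_def using assms by (intro card_Un_disjoint) auto
  then show "card (short_steps N d) = 2 * d" using assms by simp
qed (use assms in \<open>auto simp: short_steps_def\<close>)

text \<open>Not all degrees can be odd on an odd number of vertices, so one vertex,
  \<open>2 * h\<close>, stays one short. A circulant gives degree \<open>2 * d\<close>, and a
  perfect matching on the other vertices adds one.\<close>

lemma almost_regular_exists: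
  assumes "d < h"
  obtains E where "E \<subseteq> nsets {..<2 * h + 1} 2"
    "\<And>v. v < 2 * h \<Longrightarrow> edge_degree E v = 2 * d + 1" "edge_degree E (2 * h) = 2 * d"
proof -
  define N where "N = 2 * h + 1"
  define C where "C = circulant N (short_steps N d)"
  define M where "M = (\<lambda>i. {i, i + h}) ` {..<h}"
  have N: "2 * d < N" using assms by (simp add: N_def)
  note D = short_steps[OF N]
  have C: "C \<subseteq> nsets {..<N} 2" unfolding C_def using D(1) by (rule circulant_subset)
  have M: "M \<subseteq> nsets {..<N} 2" using assms by (auto simp: M_def N_def nsets_def)
  have "C \<inter> M = {}"
  proof (rule ccontr)
    assume "C \<inter> M \<noteq> {}"
    then obtain u j i where *: "{i, i + h} = {u, (u + j) mod N}" "u < N" "j \<in> short_steps N d" "i < h"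
      by (auto simp: C_def M_def circulant_def)
    then have "j < N" using D(1) by auto
    \<comment> \<open>The ends of a matching edge differ cyclically by \<open>h\<close> or
      \<open>h + 1\<close>, whereas short steps are at most \<open>d < h\<close> or at least
      \<open>2 * h + 1 - d > h + 1\<close>.\<close>
    with * have "j = h \<or> j = h + 1"
      by (auto simp: doubleton_eq_iff add_mod_eq N_def split: if_splits)
    then show False using *(3) assms by (auto simp: short_steps_def N_def)
  qed
  moreover have "finite C" "finite M"
    using C M by (auto intro: finite_subset finite_imp_finite_nsets)
  ultimately have deg: "edge_degree (C \<union> M) v = 2 * d + edge_degree M v" if "v < N" for v
    using that D by (simp add: edge_degree_Un C_def edge_degree_circulant)
  have "edge_degree M v = 1" if "v < 2 * h" for v
  proof -
    have "{e \<in> M. v \<in> e} = {{v mod h, v mod h + h}}"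
    proof (cases "v < h")
      case False
      then have "v mod h = v - h" using that by (simp add: mod_if)
      then show ?thesis using that False by (auto simp: M_def)
    qed (auto simp: M_def)
    then show ?thesis by (simp add: edge_degree_def)
  qed
  moreover have "{e \<in> M. 2 * h \<in> e} = {}" by (auto simp: M_def)
  then have "edge_degree M (2 * h) = 0" by (simp only: edge_degree_def card.empty)
  ultimately show thesis
    using deg C M by (intro that[of "C \<union> M"]) (auto simp: N_def)
qed

section \<open>The graphs \<open>B\<^sub>k\<close>\<close>

lemma B_graph_even:
  assumes "k = 2 * p"
  shows "verts (B_graph k) = {..<k + 1}" "edges (B_graph k) = nsets {..<k + 1} 2"
    "card (edges (B_graph k)) = (k + 1) * p"
    "v < k + 1 \<Longrightarrow> edge_degree (edges (B_graph k)) v = k"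
proof -
  show V: "verts (B_graph k) = {..<k + 1}" and E: "edges (B_graph k) = nsets {..<k + 1} 2"
    using assms by (simp_all add: B_graph_def complete_graph_def)
  show "card (edges (B_graph k)) = (k + 1) * p"
    unfolding E using assms by (simp add: card_nsets choose_two)
  show "edge_degree (edges (B_graph k)) v = k" if "v < k + 1"
    unfolding E using edge_degree_nsets_diff[of "{..<k + 1}" "{}" v] that
    by (simp add: edge_degree_def)
qed

text \<open>The complement has two path edges and \<open>p - 1\<close> matching edges, so
  \<open>p + 1\<close> in all. The middle vertex 1 of the path has degree 2 there, every other
  vertex degree 1.\<close>

lemma B_graph_odd:
  assumes "k + 1 = 2 * p" "p \<ge> 2"
  shows "verts (B_graph k) = {..<k + 2}" "edges (B_graph k) \<subseteq> nsets {..<k + 2} 2"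
    "card (edges (B_graph k)) + 1 = (k + 1) * p"
    "v < k + 2 \<Longrightarrow> edge_degree (edges (B_graph k)) v = (if v = 1 then k - 1 else k)"
proof -
  define M where "M = (\<lambda>i::nat. {2 * i + 1, 2 * i + 2}) ` {1..p - 1}"
  define P where "P = {{0, 1}, {1, 2}} \<union> M"
  have "odd k" "(k - 1) div 2 = p - 1" using assms by presburger+
  then have B: "B_graph k = \<lparr>verts = {..<k + 2}, edges = nsets {..<k + 2} 2 - P\<rparr>"
    by (simp add: B_graph_def complement_def path_plus_matching_def P_def M_def)
  show "verts (B_graph k) = {..<k + 2}" "edges (B_graph k) \<subseteq> nsets {..<k + 2} 2"
    by (auto simp: B)
  have P: "P \<subseteq> nsets {..<k + 2} 2"
    using assms by (auto simp: P_def M_def nsets_def)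
  have "inj_on (\<lambda>i::nat. {2 * i + 1, 2 * i + 2}) {1..p - 1}"
    by (auto simp: inj_on_def doubleton_eq_iff)
  then have "card M = p - 1" by (simp add: M_def card_image)
  moreover have "card {{0, 1}, {1, 2::nat}} = 2" by (simp add: doubleton_eq_iff)
  moreover have "\<forall>e\<in>M. 1 \<notin> e" by (auto simp: M_def)
  then have "{{0, 1}, {1, 2}} \<inter> M = {}" by blast
  moreover have "finite M" by (simp add: M_def)
  ultimately have "card P = 2 + (p - 1)"
    unfolding P_def by (subst card_Un_disjoint) auto
  then have cP: "card P = p + 1" using assms(2) by simp
  have "card (nsets {..<k + 2} 2) = (2 * p + 1) choose 2"
    using assms(1) by (simp add: card_nsets)
  also have "\<dots> = (2 * p + 1) * p" by (simp add: choose_two)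
  finally have "card (edges (B_graph k)) = (2 * p + 1) * p - (p + 1)"
    using P cP by (simp add: B card_Diff_subset finite_subset[OF P finite_imp_finite_nsets])
  moreover obtain q where "p = Suc q" using assms(2) by (cases p) auto
  ultimately show "card (edges (B_graph k)) + 1 = (k + 1) * p"
    unfolding assms(1) by (simp add: algebra_simps)
  show "edge_degree (edges (B_graph k)) v = (if v = 1 then k - 1 else k)" if v: "v < k + 2"
  proof -
    have "edge_degree P v = (if v = 1 then 2 else 1)"
    proof (cases "v \<le> 2")
      case True
      have noM: "\<forall>e\<in>M. v \<notin> e" using True by (auto simp: M_def)
      from True consider "v = 0" | "v = 1" | "v = 2" by linarith
      then show ?thesis
      proof cases
        case 1
        then have "{e \<in> P. v \<in> e} = {{0, 1}}" using noM by (auto simp: P_def)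
        then show ?thesis using 1 by (simp add: edge_degree_def)
      next
        case 2
        then have "{e \<in> P. v \<in> e} = {{0, 1}, {1, 2}}" using noM by (auto simp: P_def)
        then show ?thesis using 2 by (simp add: edge_degree_def doubleton_eq_iff)
      next
        case 3
        then have "{e \<in> P. v \<in> e} = {{1, 2}}" using noM by (auto simp: P_def)
        then show ?thesis using 3 by (simp add: edge_degree_def)
      qed
    next
      case False
      \<comment> \<open>The index of the matching edge through \<open>v\<close>: the pairs
        \<open>{2 * i + 1, 2 * i + 2}\<close> start at vertex 3.\<close>
      define i where "i = (v - 1) div 2"
      have i: "i \<in> {1..p - 1}" using v False assms by (auto simp: i_def)
      have vi: "v \<in> {2 * j + 1, 2 * j + 2} \<longleftrightarrow> j = i" for j
        using False by (auto simp: i_def)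
      have "{e \<in> P. v \<in> e} = {{2 * i + 1, 2 * i + 2}}"
      proof (intro equalityI subsetI)
        fix e assume "e \<in> {e \<in> P. v \<in> e}"
        then have "e \<in> M" and ve: "v \<in> e" using False by (auto simp: P_def)
        then obtain j where j: "e = {2 * j + 1, 2 * j + 2}" by (auto simp: M_def)
        with ve vi[of j] have "j = i" by blast
        with j show "e \<in> {{2 * i + 1, 2 * i + 2}}" by simp
      next
        fix e assume "e \<in> {{2 * i + 1, 2 * i + 2}}"
        then show "e \<in> {e \<in> P. v \<in> e}" using i vi[of i] by (auto simp: P_def M_def)
      qed
      then show ?thesis using False by (simp add: edge_degree_def)
    qed
    then show ?thesis
      using edge_degree_nsets_diff[OF _ P, of v] v by (simp add: B)
  qed
qed

section \<open>Upper bound for graphs containing a copy of \<open>B_graph k\<close>\<close>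

lemma cms_bound:
  fixes H :: "'a sgraph"
  assumes k: "k \<ge> 2" and H: "simple_graph H" "has_as_subgraph H (B_graph k)"
  shows "(k + 1) * cms H \<le> card (edges H)"
proof -
  obtain F f where F: "subgraph F H" and f: "bij_betw f (verts (B_graph k)) (verts F)"
    and A: "edges F = (`) f ` edges (B_graph k)"
    using H(2) unfolding has_as_subgraph_def isomorphic_def by blast
  have inj: "inj_on f (verts (B_graph k))" using f by (simp add: bij_betw_def)
  have V: "card (verts F) = card (verts (B_graph k))" using bij_betw_same_card[OF f] by simp
  have F': "finite (verts F)" "edges F \<subseteq> nsets (verts F) 2" "edges F \<subseteq> edges H"
    using F by (simp_all add: subgraph_def simple_graph_def)
  have fin: "finite (edges H)"
    using H(1) by (auto simp: simple_graph_def intro: finite_subset finite_imp_finite_nsets)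
  have B: "edges (B_graph k) \<subseteq> Pow (verts (B_graph k))"
    by (cases "even k") (auto simp: B_graph_def complete_graph_def complement_def
        path_plus_matching_def nsets_def)
  have card_F: "card (edges F) = card (edges (B_graph k))"
    unfolding A using inj_on_subset[OF inj_on_image_Pow[OF inj] B] by (rule card_image)
  show ?thesis
  proof (cases "even k")
    case True
    then obtain p where p: "k = 2 * p" by (elim evenE)
    have c: "card (edges F) = (k + 1) * p" using B_graph_even(3)[OF p] card_F by simp
    then have "edges F \<noteq> {}" using k p by auto
    \<comment> \<open>The windows consist of edges of the copy \<open>F\<close> only, but a full
      round has length \<open>card (edges H)\<close>.\<close>
    from cms_spread_enumeration[OF fin F'(3) this F'(2,1)]
    obtain Q E where "spread_enumeration (edges F) (verts F) Q E (cms H) (card (edges H))" .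
    then show ?thesis
      using spread_enumeration.even_case[OF _ c] k p V B_graph_even(1)[OF p] by simp
  next
    case False
    then obtain q where q: "k = 2 * q + 1" by (elim oddE)
    define p where "p = q + 1"
    have p: "k + 1 = 2 * p" "p \<ge> 2" using q k by (simp_all add: p_def)
    note Bo = B_graph_odd[OF p]
    have c: "card (edges F) + 1 = (k + 1) * p" using Bo(3) card_F by simp
    then have "edges F \<noteq> {}" using p by auto
    from cms_spread_enumeration[OF fin F'(3) this F'(2,1)]
    obtain Q E where QE: "spread_enumeration (edges F) (verts F) Q E (cms H) (card (edges H))" .
    show ?thesis
    proof (rule spread_enumeration.odd_case[OF QE c p])
      show "card (verts F) = 2 * p + 1" using V Bo(1) p(1) by simp
      \<comment> \<open>The image of the middle vertex of the path serves as
        \<open>w\<close>.\<close>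
      show "f 1 \<in> verts F" using bij_betwE[OF f] Bo(1) by auto
      have "edge_degree (edges F) (f 1) = k - 1"
        unfolding A using edge_degree_image[OF inj B, of 1] Bo(1) Bo(4)[of 1] by simp
      then show "card {e \<in> edges F. f 1 \<in> e} = k - 1" by (simp add: edge_degree_def)
    qed
  qed
qed

section \<open>Regular graphs containing \<open>B\<^sub>k\<close>\<close>

lemma has_as_subgraphI:
  assumes "simple_graph B" "verts B \<subseteq> verts G" "edges B \<subseteq> edges G"
  shows "has_as_subgraph G B"
proof -
  have "isomorphic B B" unfolding isomorphic_def by (rule exI[of _ id]) simp
  then show ?thesis using assms by (auto simp: has_as_subgraph_def subgraph_def)
qed

lemma shift_subset:
  fixes b n :: nat
  assumes "F \<subseteq> nsets {..<N} 2" "b + N \<le> n"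
  shows "(`) ((+) b) ` F \<subseteq> nsets {..<n} 2"
proof
  fix e assume "e \<in> (`) ((+) b) ` F"
  then obtain e' where e': "e' \<in> nsets {..<N} 2" and e: "e = (+) b ` e'" using assms(1) by blast
  have "card e = card e'" unfolding e by (rule card_image) simp
  with e' e assms(2) show "e \<in> nsets {..<n} 2" by (auto simp: nsets_def)
qed

lemma nsets_lessThan_mono: "E \<subseteq> nsets {..<b::nat} 2 \<Longrightarrow> b \<le> n \<Longrightarrow> E \<subseteq> nsets {..<n} 2"
  using nsets_mono[of "{..<b}" "{..<n}" 2] by auto

text \<open>\<open>B_graph k\<close> is already \<open>k\<close>-regular here, so a
  \<open>k\<close>-regular circulant on the other \<open>n - (k + 1)\<close> vertices completes it;
  the bound on \<open>n\<close> leaves room for \<open>k\<close> distinct steps.\<close>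

lemma regular_extension_even:
  assumes k: "even k" and n: "n \<ge> 2 * k + 2"
  shows "\<exists>G :: nat sgraph. simple_graph G \<and> card (verts G) = n \<and> regular k G
    \<and> has_as_subgraph G (B_graph k)"
proof -
  obtain p where p: "k = 2 * p" using k by (elim evenE)
  define b where "b = k + 1"
  define N where "N = n - b"
  have N: "2 * p < N" "b + N = n" using n p by (simp_all add: N_def b_def)
  note D = short_steps[OF N(1)] and B = B_graph_even[OF p, folded b_def]
  define C where "C = circulant N (short_steps N p)"
  have C: "C \<subseteq> nsets {..<N} 2" unfolding C_def using D(1) by (rule circulant_subset)
  define G where "G = \<lparr>verts = {..<n}, edges = edges (B_graph k) \<union> (`) ((+) b) ` C\<rparr>"
  have "edges G \<subseteq> nsets {..<n} 2"
    using shift_subset[OF C, of b n] nsets_lessThan_mono[of "edges (B_graph k)" b n] B(2) N(2)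
    by (simp add: G_def)
  then have "simple_graph G" by (simp add: simple_graph_def G_def)
  moreover have "regular k G"
    unfolding regular_def degree_eq_edge_degree
  proof
    fix v assume v: "v \<in> verts G"
    have "edges (B_graph k) \<subseteq> Pow {..<b}" by (auto simp: B(2) nsets_def)
    from edge_degree_disjoint_union[OF this]
    have "edge_degree (edges G) v =
        (if v < b then edge_degree (edges (B_graph k)) v else edge_degree C (v - b))"
      by (simp add: G_def)
    also have "\<dots> = k"
      using v N B(4)[of v] edge_degree_circulant[OF D(1,2), of "v - b"] D(3) p
      by (auto simp: C_def G_def)
    finally show "edge_degree (edges G) v = k" .
  qed
  moreover have "has_as_subgraph G (B_graph k)"
    using N(2) B by (intro has_as_subgraphI) (auto simp: simple_graph_def G_def)
  ultimately show ?thesis by (intro exI[of _ G]) (simp add: G_def)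
qed

text \<open>As \<open>n\<close> is even and \<open>k\<close> odd, the number
  \<open>n - (k + 2)\<close> of new vertices is odd, \<open>2 * h + 1\<close> say, and the bound on
  \<open>n\<close> gives \<open>d < h\<close> for \<open>k = 2 * d + 1\<close>.\<close>

lemma regular_extension_odd:
  assumes k: "odd k" "k \<ge> 3" and n: "even n" "n \<ge> 2 * k + 4"
  shows "\<exists>G :: nat sgraph. simple_graph G \<and> card (verts G) = n \<and> regular k G
    \<and> has_as_subgraph G (B_graph k)"
proof -
  obtain d where d: "k = 2 * d + 1" using k by (elim oddE)
  define b where "b = k + 2"
  have "odd (n - b)" using k n by (simp add: b_def)
  then obtain h where h: "n - b = 2 * h + 1" by (elim oddE)
  have "d < h" and bh: "b + (2 * h + 1) = n" using h n d by (simp_all add: b_def)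
  from almost_regular_exists[OF \<open>d < h\<close>] obtain E where E: "E \<subseteq> nsets {..<2 * h + 1} 2"
    "\<And>v. v < 2 * h \<Longrightarrow> edge_degree E v = 2 * d + 1" "edge_degree E (2 * h) = 2 * d" by metis
  have p: "k + 1 = 2 * (d + 1)" "d + 1 \<ge> 2" using d k by simp_all
  note B = B_graph_odd[OF p, folded b_def]
  define U where "U = edges (B_graph k) \<union> (`) ((+) b) ` E"
  define G where "G = \<lparr>verts = {..<n}, edges = U \<union> {{1, b + 2 * h}}\<rparr>"
  have U: "U \<subseteq> nsets {..<n} 2"
    using shift_subset[OF E(1), of b n] nsets_lessThan_mono[OF B(2), of n] bh
    by (simp add: U_def)
  moreover have "{1, b + 2 * h} \<in> nsets {..<n} 2"
    using bh by (auto simp: nsets_def b_def)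
  ultimately have "simple_graph G" by (simp add: simple_graph_def G_def)
  moreover have "regular k G"
    unfolding regular_def degree_eq_edge_degree
  proof
    fix v assume v: "v \<in> verts G"
    have Bb: "edges (B_graph k) \<subseteq> Pow {..<b}" using B(2) by (auto simp: nsets_def)
    then have "{1, b + 2 * h} \<notin> edges (B_graph k)" by auto
    moreover have "1 \<notin> (+) b ` e" for e by (auto simp: b_def)
    then have "{1, b + 2 * h} \<notin> (`) ((+) b) ` E" by blast
    ultimately have "U \<inter> {{1, b + 2 * h}} = {}" by (simp add: U_def)
    moreover have "finite U" using U by (auto intro: finite_subset finite_imp_finite_nsets)
    ultimately have "edge_degree (edges G) v = edge_degree U v + edge_degree {{1, b + 2 * h}} v"
      using edge_degree_Un[of U "{{1, b + 2 * h}}" v] by (simp add: G_def)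
    also have "edge_degree U v =
        (if v < b then edge_degree (edges (B_graph k)) v else edge_degree E (v - b))"
      unfolding U_def using Bb by (rule edge_degree_disjoint_union)
    also have "\<dots> = (if v = 1 \<or> v = b + 2 * h then k - 1 else k)"
      using v B(4)[of v] E(2)[of "v - b"] E(3) d bh k(2) by (auto simp: G_def b_def)
    also have "edge_degree {{1, b + 2 * h}} v = (if v = 1 \<or> v = b + 2 * h then 1 else 0)"
    proof -
      have "{e \<in> {{1, b + 2 * h}}. v \<in> e} = (if v = 1 \<or> v = b + 2 * h then {{1, b + 2 * h}} else {})"
        by auto
      then show ?thesis by (simp add: edge_degree_def)
    qed
    finally show "edge_degree (edges G) v = k" using k by (simp split: if_splits)
  qed
  moreover have "has_as_subgraph G (B_graph k)"
    using bh B by (intro has_as_subgraphI) (auto simp: simple_graph_def G_def U_def)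
  ultimately show ?thesis by (intro exI[of _ G]) (simp add: G_def)
qed

theorem theorem4p4:
  fixes k :: nat
  assumes "k \<ge> 2"
  shows "(\<forall>H :: 'a sgraph. simple_graph H \<and> has_as_subgraph H (B_graph k) \<longrightarrow>
            real (cms H) \<le> 1 / (real k + 1) * real (card (edges H)))
       \<and> (\<forall>n :: nat. n \<ge> 3 * k + 5 \<and> even (n * k) \<longrightarrow>
            (\<exists>G :: nat sgraph. simple_graph G \<and> card (verts G) = n \<and> regular k G
               \<and> has_as_subgraph G (B_graph k)))"
proof (intro conjI allI impI)
  fix H :: "'a sgraph"
  assume "simple_graph H \<and> has_as_subgraph H (B_graph k)"
  then have "(k + 1) * cms H \<le> card (edges H)" using cms_bound[OF assms] by blast
  then have "real ((k + 1) * cms H) \<le> real (card (edges H))" by (simp only: of_nat_le_iff)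
  then show "real (cms H) \<le> 1 / (real k + 1) * real (card (edges H))"
    by (simp add: field_simps)
next
  fix n :: nat
  assume n: "3 * k + 5 \<le> n \<and> even (n * k)"
  show "\<exists>G :: nat sgraph. simple_graph G \<and> card (verts G) = n \<and> regular k G
      \<and> has_as_subgraph G (B_graph k)"
  proof (cases "even k")
    case True
    with n show ?thesis by (intro regular_extension_even) auto
  next
    case False
    \<comment> \<open>For odd \<open>k\<close>, evenness of \<open>n * k\<close> makes
      \<open>n\<close> even.\<close>
    with assms have "k \<ge> 3" by (cases "k = 2") auto
    with False n show ?thesis by (intro regular_extension_odd) auto
  qed
qed

end
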